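(* Let $m,n$ be positive integers and $p\in[1,+\infty]$. The Banach space of $m\times n$ real matrices equipped with the Schatten-$p$ norm is strictly convex if and only if $p\in(1,+\infty)$. In this case (i.e. for $p\in(1,+\infty)$), the function $\mathrm J_{S_p}:\mathbb R^{m\times n}\to\mathbb R^{m\times n}$ is continuous.
   Context: For $\mathbf A\in\mathbb R^{m\times n}$ with positive singular values $\sigma_1\ge\cdots\ge\sigma_r>0$, the Schatten norms are $\|\mathbf A\|_{S_p}=(\sum_{i=1}^r\sigma_i^p)^{1/p}$ for $1\le p<\infty$, and $\|\mathbf A\|_{S_\infty}=\sigma_1$. Let $q$ be defined by $\frac1p+\frac1q=1$; $\|\cdot\|_{S_q}$ is the dual norm of $\|\cdot\|_{S_p}$ with respect to $\langle\mathbf A,\mathbf B\rangle=\mathrm{Tr}(\mathbf A^T\mathbf B)$. Duality mapping: $\mathcal J_{S_p}(\mathbf A)$ is the set of all $\mathbf B\in\mathbb R^{m\times n}$ with $\mathrm{Tr}(\mathbf A^T\mathbf B)=\|\mathbf A\|_{S_p}\|\mathbf B\|_{S_q}$ and $\|\mathbf B\|_{S_q}=\|\mathbf A\|_{S_p}$. For $p\in(1,\infty)$ this set is a singleton for every $\mathbf A$, and $\mathrm J_{S_p}(\mathbf A)$ denotes its unique element.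
   Formalization: The equivalence is stated only for m,n ≥ 2, since for min(m,n)=1 every Schatten norm is Euclidean, hence strictly convex also for p=1 and p=+∞; strict convexity and continuity of J for p in (1,+∞) are stated for all positive m,n. *)

theory Defs
  imports "HOL-Analysis.Analysis"
begin

definition singular_space :: "real^'n^'m \<Rightarrow> real \<Rightarrow> (real^'n) set" where
  "singular_space A \<sigma> = {v. (transpose A ** A) *v v = \<sigma>\<^sup>2 *\<^sub>R v}"

definition positive_singular_values :: "real^'n^'m \<Rightarrow> real set" where
  "positive_singular_values A = {\<sigma>. 0 < \<sigma> \<and> (\<exists>v. v \<noteq> 0 \<and> v \<in> singular_space A \<sigma>)}"

text \<open>The usual list \<open>\<sigma>\<^sub>1 \<ge> \<dots> \<ge> \<sigma>\<^sub>r > 0\<close> contains each \<open>\<sigma>\<close> exactly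
  \<open>dim (singular_space A \<sigma>)\<close> times, hence the weights in the sum below.
  The element \<open>0\<close> inserted under \<open>Max\<close> only matters for \<open>A = 0\<close>, where
  there is no positive singular value. Only \<open>1 \<le> p\<close> is meaningful.\<close>

definition schatten_norm :: "ennreal \<Rightarrow> real^'n^'m \<Rightarrow> real" where
  "schatten_norm p A =
     (if p = \<infinity> then Max (insert 0 (positive_singular_values A))
      else (\<Sum>\<sigma>\<in>positive_singular_values A.
              real (dim (singular_space A \<sigma>)) * \<sigma> powr enn2real p) powr (1 / enn2real p))"

definition conjugate_exponent :: "ennreal \<Rightarrow> ennreal" where
  "conjugate_exponent p = (THE q. 1 / p + 1 / q = 1)"

lemma ex1_conjugate_exponent:
  fixes p :: ennreal
  assumes "1 \<le> p"
  shows "\<exists>!q. 1 / p + 1 / q = 1"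
proof -
  have le: "1 / p \<le> 1"
    using assms by (metis divide_le_posI_ennreal mult.right_neutral not_gr_zero not_one_le_zero)
  have "1 / p + 1 / inverse (1 - 1 / p) = 1"
    using le divide_ennreal_def one_divide_one_divide_ennreal by auto
  moreover have "q = inverse (1 - 1 / p)" if "1 / p + 1 / q = 1" for q :: ennreal
  proof -
    have "1 / q = 1 - 1 / p"
      using that by (metis add_top_left_ennreal ennreal_add_diff_cancel_left ennreal_top_neq_one)
    then show ?thesis
      by (metis one_divide_one_divide_ennreal divide_ennreal_def mult_1)
  qed
  ultimately show ?thesis by metis
qed

text \<open>Strict convexity of a real vector space with respect to an explicitly given norm
  \<open>N\<close>, which need not be the norm of the type class.\<close>

definition strictly_convex_norm :: "('a::real_vector \<Rightarrow> real) \<Rightarrow> bool" where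
  "strictly_convex_norm N \<longleftrightarrow>
     (\<forall>x y. N x = 1 \<and> N y = 1 \<and> x \<noteq> y \<longrightarrow>
        (\<forall>t. 0 < t \<and> t < 1 \<longrightarrow> N (t *\<^sub>R x + (1 - t) *\<^sub>R y) < 1))"

definition duality_set :: "ennreal \<Rightarrow> real^'n^'m \<Rightarrow> (real^'n^'m) set" where
  "duality_set p A =
     {B. trace (transpose A ** B) = schatten_norm p A * schatten_norm (conjugate_exponent p) B
       \<and> schatten_norm (conjugate_exponent p) B = schatten_norm p A}"

definition duality_map :: "ennreal \<Rightarrow> real^'n^'m \<Rightarrow> real^'n^'m" where
  "duality_map p A = (THE B. B \<in> duality_set p A)"

end

theory Submission
  imports Defs
begin

text \<open>
  For \<open>1 < p < \<infinity>\<close> the \<open>p\<close>-th power of the Schatten norm is strictly convex. Write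
  \<open>M = t A + (1 - t) B\<close> in its singular value decomposition with right and left singular vectors
  \<open>w\<close> and \<open>u w\<close>. The singular values of \<open>M\<close> are the convex combinations of
  \<open>u w \<bullet> A w\<close> and \<open>u w \<bullet> B w\<close>, and the \<open>p\<close>-th powers of these numbers sum to at most
  \<open>\<parallel>A\<parallel>\<^sup>p\<close> and \<open>\<parallel>B\<parallel>\<^sup>p\<close>. Equality makes the Frobenius distance of \<open>A\<close> and \<open>M\<close> vanish.

  Strict convexity of the dual norm together with Hoelder's inequality makes the duality map
  single-valued; its graph is closed and it is locally bounded, so it is continuous. For
  \<open>p = 1\<close> and \<open>p = \<infinity>\<close>, matrices with only two nonzero entries, in different rows and columns,
  span a copy of the plane with the sum norm and the maximum norm, respectively.
\<close>

subsection \<open>Singular value decomposition\<close>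

text \<open>For the combination \<open>y\<close> built from the coefficients of \<open>x\<close>,
  the product \<open>x \<bullet> y\<close> equals the sum and \<open>(norm y)\<^sup>2\<close> is at
  most the sum, so expanding \<open>(norm (x - y))\<^sup>2\<close> suffices. The family is indexed
  and may contain zero vectors, because \<open>sgn (A *v v)\<close> vanishes on the kernel of
  \<open>A\<close>.\<close>

lemma bessel_inequality:
  fixes f :: "'i \<Rightarrow> 'a::real_inner"
  assumes "finite I" and orth: "pairwise (\<lambda>i j. orthogonal (f i) (f j)) I"
    and le1: "\<And>i. i \<in> I \<Longrightarrow> norm (f i) \<le> 1"
  shows "(\<Sum>i\<in>I. (x \<bullet> f i)\<^sup>2) \<le> (norm x)\<^sup>2"
proof -
  define y where "y = (\<Sum>i\<in>I. (x \<bullet> f i) *\<^sub>R f i)"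
  have "(norm y)\<^sup>2 = (\<Sum>i\<in>I. (norm ((x \<bullet> f i) *\<^sub>R f i))\<^sup>2)"
    unfolding y_def using orth
    by (intro norm_sum_Pythagorean \<open>finite I\<close>) (auto simp: pairwise_def orthogonal_clauses)
  also have "\<dots> \<le> (\<Sum>i\<in>I. (x \<bullet> f i)\<^sup>2)"
  proof (rule sum_mono)
    fix i assume "i \<in> I"
    then have "(norm (f i))\<^sup>2 \<le> 1"
      using le1 by (simp add: abs_square_le_1)
    then show "(norm ((x \<bullet> f i) *\<^sub>R f i))\<^sup>2 \<le> (x \<bullet> f i)\<^sup>2"
      by (simp add: power_mult_distrib mult_left_le)
  qed
  finally have 1: "(norm y)\<^sup>2 \<le> (\<Sum>i\<in>I. (x \<bullet> f i)\<^sup>2)" .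
  have 2: "x \<bullet> y = (\<Sum>i\<in>I. (x \<bullet> f i)\<^sup>2)"
    by (simp add: y_def inner_sum_right power2_eq_square)
  have "0 \<le> (norm (x - y))\<^sup>2"
    by simp
  also have "\<dots> = (norm x)\<^sup>2 - 2 * (x \<bullet> y) + (norm y)\<^sup>2"
    by (simp add: power2_norm_eq_inner inner_diff inner_commute)
  finally show ?thesis
    using 1 2 by linarith
qed

lemma orthonormal_parseval:
  fixes V :: "'a::euclidean_space set"
  assumes "finite V" "pairwise orthogonal V" "\<And>v. v \<in> V \<Longrightarrow> norm v = 1" "span V = UNIV"
  shows "(\<Sum>v\<in>V. (x \<bullet> v) * (y \<bullet> v)) = x \<bullet> y"
proof -
  have "(\<Sum>v\<in>V. (x \<bullet> v) * (y \<bullet> v)) = (\<Sum>v\<in>V. (x \<bullet> v) *\<^sub>R v) \<bullet> y"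
    by (simp add: inner_sum_left inner_commute[of y])
  also have "(\<Sum>v\<in>V. (x \<bullet> v) *\<^sub>R v) = x"
    using assms by (intro orthonormal_basis_expand) auto
  finally show ?thesis .
qed

text \<open>A maximiser \<open>v\<close> of \<open>norm (f x)\<close> on the unit sphere of \<open>S\<close> splits off: the first-order
  condition says that \<open>f\<close> maps the orthogonal complement of \<open>v\<close> in \<open>S\<close> to vectors orthogonal
  to \<open>f v\<close>.\<close>

lemma linear_orthogonal_images_subspace:
  fixes f :: "'a::euclidean_space \<Rightarrow> 'b::euclidean_space"
  assumes f: "linear f" and "subspace S"
  shows "\<exists>V. finite V \<and> pairwise orthogonal V \<and> (\<forall>v\<in>V. norm v = 1) \<and> span V = S
             \<and> pairwise (\<lambda>v w. orthogonal (f v) (f w)) V"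
  using \<open>subspace S\<close>
proof (induction "dim S" arbitrary: S)
  case 0
  then have "S = {0}"
    using dim_eq_0[of S] subspace_0[of S] by auto
  then show ?case
    by (intro exI[of _ "{}"]) auto
next
  case (Suc k)
  interpret f: linear f by fact
  let ?K = "{x\<in>S. norm x = 1}"
  have "S \<noteq> {0}"
    using Suc.hyps(2) by auto
  then obtain x where "x \<in> S" "x \<noteq> 0"
    using subspace_0[OF Suc.prems] by blast
  then have "x /\<^sub>R norm x \<in> ?K"
    using Suc.prems by (auto simp: subspace_scale)
  then have "?K \<noteq> {}" by blast
  moreover have "compact ?K"
  proof -
    have "?K = S \<inter> sphere 0 1" by (auto simp: sphere_def)
    then show ?thesis
      using closed_subspace[OF Suc.prems] by (simp add: closed_Int_compact)
  qed
  moreover have "continuous_on ?K (\<lambda>x. norm (f x))"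
    using f by (intro continuous_on_norm linear_continuous_on) (simp add: linear_conv_bounded_linear)
  ultimately obtain v where v: "v \<in> S" "norm v = 1"
    and max: "\<And>y. y \<in> S \<Longrightarrow> norm y = 1 \<Longrightarrow> norm (f y) \<le> norm (f v)"
    using continuous_attains_sup[of ?K "\<lambda>x. norm (f x)"] by blast
  \<comment> \<open>Homogeneity carries maximality from the unit sphere to all of
    \<open>S\<close>.\<close>
  have max': "(norm (f y))\<^sup>2 \<le> (norm (f v))\<^sup>2 * (norm y)\<^sup>2" if "y \<in> S" for y
  proof (cases "y = 0")
    case False
    have "norm (f (y /\<^sub>R norm y)) \<le> norm (f v)"
      using False that Suc.prems by (intro max) (auto simp: subspace_scale)
    then have "norm (f y) \<le> norm (f v) * norm y"
      using False by (simp add: f.scaleR divide_simps mult.commute)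
    then show ?thesis
      by (metis norm_ge_zero power_mono power_mult_distrib)
  qed (simp add: f.zero)
  define S' where "S' = {y\<in>S. orthogonal v y}"
  have S': "subspace S'"
    unfolding S'_def using Suc.prems
    by (auto simp: subspace_def orthogonal_clauses)
  have im: "orthogonal (f v) (f y)" if "y \<in> S'" for y
  proof -
    have y: "y \<in> S" "v \<bullet> y = 0"
      using that by (auto simp: S'_def orthogonal_def)
    define b c where "b = f v \<bullet> f y" and "c = (norm (f v))\<^sup>2 * (norm y)\<^sup>2"
    \<comment> \<open>Perturb the maximiser to \<open>v + t *\<^sub>R y\<close>: the constant terms
      cancel, which leaves a linear term in \<open>t\<close>, of either sign, against a quadratic
      one.\<close>
    have le: "2 * t * b \<le> t\<^sup>2 * c" for t
    proof -
      have "(norm (f (v + t *\<^sub>R y)))\<^sup>2 \<le> (norm (f v))\<^sup>2 * (norm (v + t *\<^sub>R y))\<^sup>2"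
        using y v Suc.prems by (intro max') (auto simp: subspace_add subspace_scale)
      moreover have "(norm (f (v + t *\<^sub>R y)))\<^sup>2 = (norm (f v))\<^sup>2 + 2 * t * b + t\<^sup>2 * (norm (f y))\<^sup>2"
        unfolding b_def power2_norm_eq_inner
        by (simp add: f.add f.scaleR inner_add inner_commute power2_eq_square algebra_simps)
      moreover have "(norm (v + t *\<^sub>R y))\<^sup>2 = 1 + t\<^sup>2 * (norm y)\<^sup>2"
        using v y unfolding power2_norm_eq_inner
        by (simp add: inner_add inner_commute power2_eq_square algebra_simps norm_eq_1)
      ultimately have "2 * t * b + t\<^sup>2 * (norm (f y))\<^sup>2 \<le> t\<^sup>2 * c"
        unfolding c_def by (simp add: algebra_simps)
      moreover have "0 \<le> t\<^sup>2 * (norm (f y))\<^sup>2" by simp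
      ultimately show ?thesis by linarith
    qed
    have "c \<ge> 0" by (simp add: c_def)
    have "b = 0"
    proof (rule ccontr)
      assume "b \<noteq> 0"
      \<comment> \<open>The quadratic \<open>t\<^sup>2 * c - 2 * t * b\<close> is minimal at
        \<open>t = b / c\<close>; the denominator \<open>c + 1\<close> stays positive even if
        \<open>c = 0\<close> and still gives a negative value.\<close>
      have "2 * (b / (c + 1)) * b \<le> (b / (c + 1))\<^sup>2 * c"
        by (rule le)
      also have "\<dots> = b\<^sup>2 / (c + 1) * (c / (c + 1))"
        by (simp add: power2_eq_square)
      also have "\<dots> \<le> b\<^sup>2 / (c + 1) * 1"
        using \<open>c \<ge> 0\<close> by (intro mult_left_mono) (auto simp: divide_simps)
      finally have "b\<^sup>2 / (c + 1) \<le> 0"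
        by (simp add: power2_eq_square)
      moreover have "b\<^sup>2 / (c + 1) > 0"
        using \<open>b \<noteq> 0\<close> \<open>c \<ge> 0\<close> by simp
      ultimately show False by linarith
    qed
    then show ?thesis
      by (simp add: b_def orthogonal_def)
  qed
  \<comment> \<open>Splitting off the line through \<open>v\<close> lowers the dimension by one, so
    that the induction hypothesis applies to \<open>S'\<close>.\<close>
  have "dim S' + dim (span {v}) = dim S"
  proof -
    have "{y \<in> S. \<forall>x \<in> span {v}. orthogonal x y} = S'"
      unfolding S'_def
      using orthogonal_to_span[of _ "{v}"] span_base[of v "{v}"]
      by (metis (no_types, opaque_lifting) orthogonal_commute singletonD singletonI)
    then show ?thesis
      using dim_subspace_orthogonal_to_vectors[of "span {v}" S] Suc.prems v
      by (simp add: span_minimal)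
  qed
  moreover have "v \<noteq> 0"
    using v by auto
  ultimately have "dim S' = k"
    using Suc.hyps(2) by (simp add: dim_span dim_singleton)
  then obtain V where V: "finite V" "pairwise orthogonal V" "\<forall>v\<in>V. norm v = 1" "span V = S'"
    "pairwise (\<lambda>v w. orthogonal (f v) (f w)) V"
    using Suc.hyps(1)[of S'] S' by auto
  have VS': "V \<subseteq> S'"
    using V(4) span_superset by blast
  have "span (insert v V) = S"
  proof
    show "span (insert v V) \<subseteq> S"
      using VS' v Suc.prems by (intro span_minimal) (auto simp: S'_def)
    show "S \<subseteq> span (insert v V)"
    proof
      fix x assume "x \<in> S"
      then have "x - (v \<bullet> x) *\<^sub>R v \<in> S'"
        using v Suc.prems
        by (auto simp: S'_def orthogonal_def inner_diff norm_eq_1 subspace_diff subspace_scale)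
      then show "x \<in> span (insert v V)"
        using V(4) span_breakdown_eq by blast
    qed
  qed
  then show ?case
    using V v VS' im
    by (intro exI[of _ "insert v V"])
      (auto simp: pairwise_insert S'_def orthogonal_commute)
qed

section \<open>Orthonormal bases of right singular vectors\<close>

text \<open>This encodes a singular value decomposition by its right singular vectors alone: the
  singular values, including zeros, are the numbers \<open>norm (A *v v)\<close>, and
  \<open>sgn (A *v v)\<close> are the left singular vectors.\<close>

definition singular_basis :: "real^'n^'m \<Rightarrow> (real^'n) set \<Rightarrow> bool" where
  "singular_basis A V \<longleftrightarrow> finite V \<and> pairwise orthogonal V \<and> (\<forall>v\<in>V. norm v = 1) \<and> span V = UNIV
     \<and> pairwise (\<lambda>v w. orthogonal (A *v v) (A *v w)) V"

lemma singular_basis_exists: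
  obtains V where "singular_basis A V"
  using linear_orthogonal_images_subspace[OF matrix_vector_mul_linear[of A] subspace_UNIV]
  by (auto simp: singular_basis_def)

lemma singular_basisD:
  assumes "singular_basis A V"
  shows "finite V" "pairwise orthogonal V" "\<And>v. v \<in> V \<Longrightarrow> norm v = 1" "span V = UNIV"
    "pairwise (\<lambda>v w. orthogonal (A *v v) (A *v w)) V" "independent V"
proof -
  show "independent V"
    using assms by (intro pairwise_orthogonal_independent) (auto simp: singular_basis_def)
qed (use assms in \<open>auto simp: singular_basis_def\<close>)

lemma singular_basis_inner:
  assumes "singular_basis A V" "v \<in> V" "w \<in> V"
  shows "v \<bullet> w = (if v = w then 1 else 0)"
    and "(A *v v) \<bullet> (A *v w) = (if v = w then (norm (A *v v))\<^sup>2 else 0)"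
  using assms
  by (auto simp: singular_basis_def pairwise_def orthogonal_def norm_eq_1 power2_norm_eq_inner)

text \<open>Left singular vectors are unit vectors where \<open>A *v v \<noteq> 0\<close> and zero
  on the rest of the basis, hence only a bound on their norm.\<close>

lemma singular_basis_sgn:
  assumes "singular_basis A V"
  shows "pairwise (\<lambda>v w. orthogonal (sgn (A *v v)) (sgn (A *v w))) V"
    and "norm (sgn (A *v v)) \<le> 1"
  using singular_basisD(5)[OF assms]
  by (simp_all add: pairwise_def orthogonal_def norm_sgn) (simp add: sgn_div_norm)

text \<open>Parseval's identity in each row: the Frobenius product can be evaluated in any
  orthonormal basis, in particular in one adapted to a third matrix \<open>C\<close>.\<close>

lemma inner_matrix_eq_sum:
  assumes "singular_basis C V"
  shows "A \<bullet> B = (\<Sum>v\<in>V. (A *v v) \<bullet> (B *v v))"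
proof -
  have "(\<Sum>v\<in>V. (A *v v) \<bullet> (B *v v)) = (\<Sum>v\<in>V. \<Sum>k\<in>UNIV. (A $ k \<bullet> v) * (B $ k \<bullet> v))"
    by (simp add: inner_vec_def[of "A *v _"] matrix_vector_mul_component)
  also have "\<dots> = (\<Sum>k\<in>UNIV. \<Sum>v\<in>V. (A $ k \<bullet> v) * (B $ k \<bullet> v))"
    by (rule sum.swap)
  also have "\<dots> = (\<Sum>k\<in>UNIV. A $ k \<bullet> B $ k)"
    using singular_basisD[OF assms] by (simp add: orthonormal_parseval)
  finally show ?thesis
    by (simp add: inner_vec_def[of A])
qed

lemma trace_transpose_mult: "trace (transpose A ** B) = A \<bullet> B" for A B :: "real^'n^'m"
proof -
  have "trace (transpose A ** B) = (\<Sum>j\<in>UNIV. \<Sum>i\<in>UNIV. A$i$j * B$i$j)"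
    by (simp add: trace_def matrix_matrix_mult_def transpose_def)
  also have "\<dots> = (\<Sum>i\<in>UNIV. \<Sum>j\<in>UNIV. A$i$j * B$i$j)"
    by (rule sum.swap)
  finally show ?thesis
    by (simp add: inner_vec_def)
qed

lemma inner_gram: "((transpose A ** A) *v x) \<bullet> y = (A *v x) \<bullet> (A *v y)" for A :: "real^'n^'m"
  by (metis dot_lmul_matrix matrix_vector_mul_assoc transpose_matrix_vector)

text \<open>Testing against \<open>V\<close> leaves only the component along \<open>v\<close>, since
  \<open>A *v v\<close> is orthogonal to the images of the other basis vectors.\<close>

lemma singular_basis_gram:
  assumes V: "singular_basis A V" and "v \<in> V"
  shows "(transpose A ** A) *v v = (norm (A *v v))\<^sup>2 *\<^sub>R v"
proof (rule vector_eq_dot_span[of _ V])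
  fix w assume w: "w \<in> V"
  have "w \<bullet> ((transpose A ** A) *v v) = (A *v w) \<bullet> (A *v v)"
    by (metis inner_commute inner_gram)
  then show "w \<bullet> ((transpose A ** A) *v v) = w \<bullet> ((norm (A *v v))\<^sup>2 *\<^sub>R v)"
    using singular_basis_inner[OF V w \<open>v \<in> V\<close>] by auto
qed (use singular_basisD[OF V] in auto)

text \<open>The Gram matrix is symmetric, so eigenvectors for different eigenvalues are orthogonal,
  and the expansion of an eigenvector in \<open>V\<close> only involves basis vectors with the same
  singular value.\<close>

lemma singular_space_eq_span:
  assumes V: "singular_basis A V" and "0 < \<sigma>"
  shows "singular_space A \<sigma> = span {v\<in>V. norm (A *v v) = \<sigma>}" (is "_ = span ?U")
proof
  show "span ?U \<subseteq> singular_space A \<sigma>"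
  proof (rule span_minimal)
    show "?U \<subseteq> singular_space A \<sigma>"
      using singular_basis_gram[OF V] by (auto simp: singular_space_def)
    show "subspace (singular_space A \<sigma>)"
      unfolding singular_space_def subspace_def
      by (auto simp: matrix_vector_right_distrib scaleR_add_right
          matrix_vector_mult_scaleR mult.commute)
  qed
  show "singular_space A \<sigma> \<subseteq> span ?U"
  proof
    fix x assume "x \<in> singular_space A \<sigma>"
    then have x: "(transpose A ** A) *v x = \<sigma>\<^sup>2 *\<^sub>R x"
      by (simp add: singular_space_def)
    have zero: "x \<bullet> v = 0" if v: "v \<in> V" "v \<notin> ?U" for v
    proof -
      have "\<sigma>\<^sup>2 * (x \<bullet> v) = ((transpose A ** A) *v x) \<bullet> v"
        by (simp add: x)
      also have "\<dots> = x \<bullet> ((transpose A ** A) *v v)"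
        by (metis inner_commute inner_gram)
      also have "\<dots> = (norm (A *v v))\<^sup>2 * (x \<bullet> v)"
        by (simp add: singular_basis_gram[OF V] v)
      finally have "(\<sigma>\<^sup>2 - (norm (A *v v))\<^sup>2) * (x \<bullet> v) = 0"
        by (simp add: algebra_simps)
      moreover have "\<sigma>\<^sup>2 \<noteq> (norm (A *v v))\<^sup>2"
        using v \<open>0 < \<sigma>\<close> by (auto simp: power2_eq_iff_nonneg)
      ultimately show ?thesis by simp
    qed
    have "x = (\<Sum>v\<in>V. (x \<bullet> v) *\<^sub>R v)"
      using singular_basisD[OF V] by (intro orthonormal_basis_expand[symmetric]) auto
    also have "\<dots> = (\<Sum>v\<in>?U. (x \<bullet> v) *\<^sub>R v)"
      using singular_basisD[OF V] zero by (intro sum.mono_neutral_right) auto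
    also have "\<dots> \<in> span ?U"
      by (intro span_sum span_scale span_base) auto
    finally show "x \<in> span ?U" .
  qed
qed

lemma dim_singular_space:
  assumes V: "singular_basis A V" and "0 < \<sigma>"
  shows "dim (singular_space A \<sigma>) = card {v\<in>V. norm (A *v v) = \<sigma>}"
proof -
  have "independent {v\<in>V. norm (A *v v) = \<sigma>}"
    using singular_basisD(6)[OF V] by (rule independent_mono) auto
  then show ?thesis
    unfolding singular_space_eq_span[OF assms] dim_span by (rule dim_eq_card_independent)
qed

lemma positive_singular_values_eq:
  assumes V: "singular_basis A V"
  shows "positive_singular_values A = (\<lambda>v. norm (A *v v)) ` V - {0}"
proof -
  have "(\<exists>v. v \<noteq> 0 \<and> v \<in> singular_space A \<sigma>) \<longleftrightarrow> {v\<in>V. norm (A *v v) = \<sigma>} \<noteq> {}"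
    if "0 < \<sigma>" for \<sigma>
  proof -
    have "(\<exists>v. v \<noteq> 0 \<and> v \<in> singular_space A \<sigma>) \<longleftrightarrow> \<not> singular_space A \<sigma> \<subseteq> {0}"
      by blast
    also have "\<dots> \<longleftrightarrow> dim (singular_space A \<sigma>) \<noteq> 0"
      by (simp add: dim_eq_0)
    also have "\<dots> \<longleftrightarrow> {v\<in>V. norm (A *v v) = \<sigma>} \<noteq> {}"
      unfolding dim_singular_space[OF V that] using singular_basisD(1)[OF V] by simp
    finally show ?thesis .
  qed
  then show ?thesis
    unfolding positive_singular_values_def by force
qed

section \<open>Schatten norms evaluated in a singular basis\<close>

text \<open>The \<open>p\<close>-th power of the norm. Unlike the norm, which is linear along rays,
  it can be strictly convex as a function.\<close>

definition schatten_power :: "real \<Rightarrow> real^'n^'m \<Rightarrow> real" where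
  "schatten_power p A =
     (\<Sum>\<sigma>\<in>positive_singular_values A. real (dim (singular_space A \<sigma>)) * \<sigma> powr p)"

text \<open>Group the basis vectors by their singular value: the dimension of each eigenspace counts
  its group, and the kernel contributes nothing because \<open>0 powr p = 0\<close>.\<close>

lemma schatten_power_eq:
  assumes V: "singular_basis A V"
  shows "schatten_power p A = (\<Sum>v\<in>V. norm (A *v v) powr p)"
proof -
  let ?s = "\<lambda>v. norm (A *v v)"
  have fin: "finite V" using singular_basisD[OF V] by simp
  have "(\<Sum>v\<in>V. ?s v powr p) = (\<Sum>\<sigma>\<in>?s ` V. \<Sum>v | v \<in> V \<and> ?s v = \<sigma>. ?s v powr p)"
    by (rule sum.image_gen[OF fin])
  also have "\<dots> = (\<Sum>\<sigma>\<in>?s ` V. real (card {v\<in>V. ?s v = \<sigma>}) * \<sigma> powr p)"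
    by simp
  also have "\<dots> = (\<Sum>\<sigma>\<in>?s ` V - {0}. real (card {v\<in>V. ?s v = \<sigma>}) * \<sigma> powr p)"
    using fin by (intro sum.mono_neutral_right) auto
  also have "\<dots> = schatten_power p A"
    unfolding schatten_power_def positive_singular_values_eq[OF V]
    by (intro sum.cong) (auto simp: dim_singular_space[OF V])
  finally show ?thesis by simp
qed

lemma schatten_norm_ennreal:
  "0 \<le> p \<Longrightarrow> schatten_norm (ennreal p) A = schatten_power p A powr (1 / p)"
  by (simp add: schatten_norm_def schatten_power_def)

lemma schatten_norm_infinity:
  assumes V: "singular_basis A V"
  shows "schatten_norm \<infinity> A = Max ((\<lambda>v. norm (A *v v)) ` V)"
proof -
  let ?X = "(\<lambda>v. norm (A *v v)) ` V"
  have fin: "finite ?X" using singular_basisD[OF V] by simp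
  have "V \<noteq> {}"
    using singular_basisD(4)[OF V] UNIV_not_singleton[of "0 :: real^'n"] by auto
  then obtain v where "v \<in> V" by blast
  then have "0 \<le> Max ?X"
    using fin by (meson Max_ge image_eqI norm_ge_zero order_trans)
  have "schatten_norm \<infinity> A = Max (insert 0 ?X)"
    unfolding schatten_norm_def positive_singular_values_eq[OF V] by simp
  also have "\<dots> = Max ?X"
    using fin \<open>V \<noteq> {}\<close> \<open>0 \<le> Max ?X\<close> by (simp add: max_def)
  finally show ?thesis .
qed

subsection \<open>Strict convexity\<close>

text \<open>The mean value theorem with a strictly increasing derivative. The endpoint
  \<open>0\<close> is treated directly, as the derivative formula is used only at positive
  points.\<close>

lemma powr_tangent_le:
  fixes s a p :: real
  assumes p: "1 < p" and "0 \<le> s" "0 \<le> a"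
  shows "a powr p + p * a powr (p - 1) * (s - a) \<le> s powr p"
    and "s \<noteq> a \<Longrightarrow> a powr p + p * a powr (p - 1) * (s - a) < s powr p"
proof -
  show less: "a powr p + p * a powr (p - 1) * (s - a) < s powr p" if "s \<noteq> a"
  proof (cases "a = 0 \<or> s = 0")
    case True
    have "a * a powr (p - 1) = a powr p"
      using \<open>0 \<le> a\<close> by (cases "a = 0") (simp_all add: powr_mult_base)
    then have "a powr p + p * a powr (p - 1) * (0 - a) = (1 - p) * a powr p"
      by (simp add: algebra_simps)
    moreover have "(1 - p) * a powr p < 0" if "a \<noteq> 0"
      using that p by (simp add: mult_neg_pos)
    ultimately show ?thesis
      using True that p assms by auto
  next
    case False
    then have pos: "0 < a" "0 < s" using assms by auto
    have D: "((\<lambda>x. x powr p) has_real_derivative p * x powr (p - 1)) (at x)" if "0 < x" for x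
      using that by (auto intro!: derivative_eq_intros)
    show ?thesis
    proof (cases "a < s")
      case True
      obtain z where z: "a < z" "z < s" "s powr p - a powr p = (s - a) * (p * z powr (p - 1))"
        using MVT2[OF True, of "\<lambda>x. x powr p" "\<lambda>x. p * x powr (p - 1)"] D pos by force
      have "a powr (p - 1) < z powr (p - 1)"
        using z pos p by (intro powr_less_mono2) auto
      then have "(s - a) * (p * a powr (p - 1)) < (s - a) * (p * z powr (p - 1))"
        using True p by simp
      then show ?thesis using z by (simp add: algebra_simps)
    next
      case False
      then have "s < a" using that by simp
      obtain z where z: "s < z" "z < a" "a powr p - s powr p = (a - s) * (p * z powr (p - 1))"
        using MVT2[OF \<open>s < a\<close>, of "\<lambda>x. x powr p" "\<lambda>x. p * x powr (p - 1)"] D pos by force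
      have "z powr (p - 1) < a powr (p - 1)"
        using z pos p by (intro powr_less_mono2) auto
      then have "(a - s) * (p * z powr (p - 1)) < (a - s) * (p * a powr (p - 1))"
        using \<open>s < a\<close> p by simp
      then show ?thesis using z by (simp add: algebra_simps)
    qed
  qed
  show "a powr p + p * a powr (p - 1) * (s - a) \<le> s powr p"
    using less by (cases "s = a") auto
qed

text \<open>The numbers \<open>\<bar>u w \<bullet> (A *v w)\<bar>\<close> are bounded by averages of the singular values of \<open>A\<close>
  with respect to the doubly substochastic weights
  \<open>K w v = ((u w \<bullet> sgn (A *v v))\<^sup>2 + (w \<bullet> v)\<^sup>2) / 2\<close>. Summing the tangent line inequality of
  \<open>\<lambda>x. x powr p\<close> gives the bound; equality forces \<open>norm (A *v v) = \<bar>u w \<bullet> (A *v w)\<bar>\<close>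
  wherever \<open>K w v \<noteq> 0\<close>.\<close>

lemma schatten_power_pinching:
  fixes A :: "real^'n^'m" and u :: "real^'n \<Rightarrow> real^'m"
  assumes p: "1 < p" and V: "singular_basis A V"
    and W: "finite W" "pairwise orthogonal W" "\<And>w. w \<in> W \<Longrightarrow> norm w = 1"
    and u: "pairwise (\<lambda>w w'. orthogonal (u w) (u w')) W" "\<And>w. w \<in> W \<Longrightarrow> norm (u w) \<le> 1"
  shows "(\<Sum>w\<in>W. \<bar>u w \<bullet> (A *v w)\<bar> powr p) \<le> schatten_power p A" (is ?le)
    and "(\<Sum>w\<in>W. \<bar>u w \<bullet> (A *v w)\<bar> powr p) = schatten_power p A \<Longrightarrow>
         (\<Sum>v\<in>V. (norm (A *v v))\<^sup>2) \<le> (\<Sum>w\<in>W. (u w \<bullet> (A *v w))\<^sup>2)" (is "PROP ?eq")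
proof -
  note fin = \<open>finite W\<close> singular_basisD(1)[OF V]
  define s where "s v = norm (A *v v)" for v
  define a where "a w = \<bar>u w \<bullet> (A *v w)\<bar>" for w
  define K where "K w v = ((u w \<bullet> sgn (A *v v))\<^sup>2 + (w \<bullet> v)\<^sup>2) / 2" for w v
  have K0: "0 \<le> K w v" for w v by (simp add: K_def)
  have s0: "0 \<le> s v" and a0: "0 \<le> a w" for v w by (auto simp: s_def a_def)
  have K_sum_V: "(\<Sum>v\<in>V. K w v) \<le> 1" if "w \<in> W" for w
  proof -
    have "(\<Sum>v\<in>V. (u w \<bullet> sgn (A *v v))\<^sup>2) \<le> (norm (u w))\<^sup>2"
      using singular_basis_sgn[OF V] by (intro bessel_inequality fin)
    moreover have "(\<Sum>v\<in>V. (w \<bullet> v)\<^sup>2) \<le> (norm w)\<^sup>2"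
      using singular_basisD[OF V]
      by (intro bessel_inequality fin) auto
    moreover have "(norm (u w))\<^sup>2 \<le> 1" "(norm w)\<^sup>2 = 1"
      using that u W by (auto simp: abs_square_le_1)
    ultimately show ?thesis
      unfolding K_def by (simp add: sum.distrib flip: sum_divide_distrib)
  qed
  have K_sum_W: "(\<Sum>w\<in>W. K w v) \<le> 1" if "v \<in> V" for v
  proof -
    have "(\<Sum>w\<in>W. (sgn (A *v v) \<bullet> u w)\<^sup>2) \<le> (norm (sgn (A *v v)))\<^sup>2"
      using u by (intro bessel_inequality fin) auto
    moreover have "(\<Sum>w\<in>W. (v \<bullet> w)\<^sup>2) \<le> (norm v)\<^sup>2"
      using W by (intro bessel_inequality fin) auto
    moreover have "(norm (sgn (A *v v)))\<^sup>2 \<le> 1" "(norm v)\<^sup>2 = 1"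
      using that singular_basisD(3)[OF V] by (auto simp: norm_sgn)
    ultimately show ?thesis
      unfolding K_def by (simp add: sum.distrib inner_commute flip: sum_divide_distrib)
  qed
  \<comment> \<open>Expanding \<open>w\<close> in \<open>V\<close> produces products of the two
    coefficients \<open>u w \<bullet> sgn (A *v v)\<close> and \<open>w \<bullet> v\<close>; the
    inequality of arithmetic and geometric means bounds them by \<open>K w v\<close>.\<close>
  have a_le: "a w \<le> (\<Sum>v\<in>V. K w v * s v)" for w
  proof -
    have "w = (\<Sum>v\<in>V. (w \<bullet> v) *\<^sub>R v)"
      using singular_basisD[OF V] by (intro orthonormal_basis_expand[symmetric]) auto
    then have "A *v w = A *v (\<Sum>v\<in>V. (w \<bullet> v) *\<^sub>R v)"
      by simp
    also have "\<dots> = (\<Sum>v\<in>V. (w \<bullet> v) *\<^sub>R (A *v v))"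
      by (simp add: linear_sum[OF matrix_vector_mul_linear] matrix_vector_mult_scaleR)
    also have "\<dots> = (\<Sum>v\<in>V. (w \<bullet> v) *\<^sub>R (s v *\<^sub>R sgn (A *v v)))"
      by (intro sum.cong) (auto simp: s_def sgn_div_norm)
    finally have "u w \<bullet> (A *v w) = (\<Sum>v\<in>V. s v * ((u w \<bullet> sgn (A *v v)) * (w \<bullet> v)))"
      by (simp add: inner_sum_right mult_ac)
    then have "a w \<le> (\<Sum>v\<in>V. \<bar>s v * ((u w \<bullet> sgn (A *v v)) * (w \<bullet> v))\<bar>)"
      unfolding a_def by (metis sum_abs)
    also have "\<dots> \<le> (\<Sum>v\<in>V. K w v * s v)"
    proof (rule sum_mono)
      fix v
      have "\<bar>x * y\<bar> \<le> (x\<^sup>2 + y\<^sup>2) / 2" for x y :: real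
        using sum_squares_bound[of "\<bar>x\<bar>" "\<bar>y\<bar>"] by (simp add: abs_mult)
      then have "s v * \<bar>(u w \<bullet> sgn (A *v v)) * (w \<bullet> v)\<bar> \<le> s v * K w v"
        unfolding K_def by (intro mult_left_mono s0) 
      then show "\<bar>s v * ((u w \<bullet> sgn (A *v v)) * (w \<bullet> v))\<bar> \<le> K w v * s v"
        by (simp add: abs_mult s0 mult.commute)
    qed
    finally show ?thesis .
  qed
  \<comment> \<open>The gap in the tangent line inequality is kept as a term of its own for the
    equality case.\<close>
  define T where "T w v = s v powr p - (a w powr p + p * a w powr (p - 1) * (s v - a w))" for w v
  have T0: "0 \<le> T w v" for w v
    using powr_tangent_le(1)[OF p s0 a0] by (simp add: T_def)
  have T_eq: "s v = a w" if "T w v = 0" for w v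
    using powr_tangent_le(2)[OF p s0 a0, of v w] that by (auto simp: T_def)
  have row: "a w powr p + (\<Sum>v\<in>V. K w v * T w v) \<le> (\<Sum>v\<in>V. K w v * s v powr p)" if w: "w \<in> W" for w
  proof -
    define c where "c = p * a w powr (p - 1)"
    have c: "0 \<le> c" "c * a w = p * a w powr p"
      using p a0[of w] by (auto simp: c_def powr_mult_base mult.commute mult.left_commute)
    have "(\<Sum>v\<in>V. K w v * s v powr p) - (\<Sum>v\<in>V. K w v * T w v)
        = (\<Sum>v\<in>V. (1 - p) * a w powr p * K w v + c * (K w v * s v))"
      unfolding sum_subtractf[symmetric]
    proof (rule sum.cong[OF refl])
      fix v
      have "s v powr p - T w v = a w powr p - c * a w + c * s v"
        by (simp add: T_def c_def algebra_simps)
      also have "\<dots> = (1 - p) * a w powr p + c * s v"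
        by (simp add: c algebra_simps)
      finally show "K w v * s v powr p - K w v * T w v = (1 - p) * a w powr p * K w v + c * (K w v * s v)"
        by (metis (no_types) right_diff_distrib distrib_left mult.commute mult.left_commute)
    qed
    also have "\<dots> = (1 - p) * a w powr p * (\<Sum>v\<in>V. K w v) + c * (\<Sum>v\<in>V. K w v * s v)"
      by (simp add: sum.distrib sum_distrib_left)
    also have "\<dots> \<ge> (1 - p) * a w powr p * 1 + c * a w"
    proof (rule add_mono)
      \<comment> \<open>The coefficient \<open>1 - p\<close> is negative, so a total weight below
        \<open>1\<close> only helps.\<close>
      show "(1 - p) * a w powr p * 1 \<le> (1 - p) * a w powr p * (\<Sum>v\<in>V. K w v)"
        using p K_sum_V[OF w] by (intro mult_left_mono_neg) (auto simp: mult_nonpos_nonneg)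
      show "c * a w \<le> c * (\<Sum>v\<in>V. K w v * s v)"
        using a_le c by (intro mult_left_mono)
    qed
    finally show ?thesis
      using c by (simp add: algebra_simps)
  qed
  \<comment> \<open>\<open>Q\<close> collects the tangent gaps and \<open>R\<close> the weight
    missing from the sums over \<open>W\<close>. Both are nonnegative, so equality makes both
    vanish.\<close>
  define Q where "Q = (\<Sum>w\<in>W. \<Sum>v\<in>V. K w v * T w v)"
  define R where "R = (\<Sum>v\<in>V. (1 - (\<Sum>w\<in>W. K w v)) * s v powr p)"
  have Q0: "0 \<le> Q"
    unfolding Q_def by (intro sum_nonneg mult_nonneg_nonneg K0 T0)
  have R0: "0 \<le> R"
    unfolding R_def using K_sum_W by (intro sum_nonneg mult_nonneg_nonneg) auto
  have "(\<Sum>w\<in>W. a w powr p) + Q \<le> (\<Sum>w\<in>W. \<Sum>v\<in>V. K w v * s v powr p)"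
    unfolding Q_def sum.distrib[symmetric] by (intro sum_mono row)
  also have "\<dots> = (\<Sum>v\<in>V. (\<Sum>w\<in>W. K w v) * s v powr p)"
    by (subst sum.swap) (simp add: sum_distrib_right)
  also have "\<dots> = schatten_power p A - R"
    unfolding schatten_power_eq[OF V] R_def s_def[symmetric]
    by (simp add: algebra_simps sum_subtractf)
  finally have main: "(\<Sum>w\<in>W. a w powr p) + Q + R \<le> schatten_power p A" by simp
  show ?le
    using main Q0 R0 by (simp add: a_def)
  show "PROP ?eq"
  proof -
    assume "(\<Sum>w\<in>W. \<bar>u w \<bullet> (A *v w)\<bar> powr p) = schatten_power p A"
    then have "Q = 0" "R = 0"
      using main Q0 R0 by (auto simp: a_def)
    have KT: "K w v = 0 \<or> s v = a w" if "w \<in> W" "v \<in> V" for w v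
    proof -
      have "(\<Sum>v\<in>V. K w v * T w v) = 0"
        using \<open>Q = 0\<close> that unfolding Q_def
        by (subst (asm) sum_nonneg_eq_0_iff) (auto intro!: fin sum_nonneg mult_nonneg_nonneg K0 T0)
      then have "K w v * T w v = 0"
        using that by (subst (asm) sum_nonneg_eq_0_iff) (auto intro!: fin mult_nonneg_nonneg K0 T0)
      then show ?thesis using T_eq by auto
    qed
    \<comment> \<open>Since \<open>R = 0\<close>, either the weights \<open>K w v\<close> sum to
      \<open>1\<close> over \<open>W\<close> or \<open>s v = 0\<close>.\<close>
    have Ks: "(\<Sum>w\<in>W. K w v) * (s v)\<^sup>2 = (s v)\<^sup>2" if "v \<in> V" for v
    proof -
      have "(1 - (\<Sum>w\<in>W. K w v)) * s v powr p = 0"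
        using \<open>R = 0\<close> that K_sum_W unfolding R_def
        by (subst (asm) sum_nonneg_eq_0_iff) (auto intro!: fin mult_nonneg_nonneg)
      then show ?thesis by auto
    qed
    have "(\<Sum>v\<in>V. (s v)\<^sup>2) = (\<Sum>v\<in>V. (\<Sum>w\<in>W. K w v) * (s v)\<^sup>2)"
      using Ks by (intro sum.cong) simp_all
    also have "\<dots> = (\<Sum>w\<in>W. \<Sum>v\<in>V. K w v * (s v)\<^sup>2)"
      by (subst sum.swap) (simp add: sum_distrib_right)
    also have "\<dots> = (\<Sum>w\<in>W. \<Sum>v\<in>V. K w v * (a w)\<^sup>2)"
      using KT by (intro sum.cong) force+
    also have "\<dots> \<le> (\<Sum>w\<in>W. (a w)\<^sup>2)"
    proof (rule sum_mono)
      fix w assume "w \<in> W"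
      then have "(\<Sum>v\<in>V. K w v) * (a w)\<^sup>2 \<le> 1 * (a w)\<^sup>2"
        using K_sum_V by (intro mult_right_mono) auto
      then show "(\<Sum>v\<in>V. K w v * (a w)\<^sup>2) \<le> (a w)\<^sup>2"
        by (simp add: sum_distrib_right)
    qed
    finally show "(\<Sum>v\<in>V. (norm (A *v v))\<^sup>2) \<le> (\<Sum>w\<in>W. (u w \<bullet> (A *v w))\<^sup>2)"
      by (simp add: s_def a_def)
  qed
qed

text \<open>The tangent at \<open>m\<close> has nonnegative slope, so it lies below the graph of
  \<open>\<bar>x\<bar> powr p\<close> on the whole line, for both signs of \<open>a\<close> and
  \<open>b\<close>. Equality forces \<open>\<bar>a\<bar> = \<bar>b\<bar> = m\<close>.\<close>

lemma powr_convex_combination: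
  fixes a b m p t :: real
  assumes p: "1 < p" and t: "0 < t" "t < 1" and m: "0 \<le> m" "m = t * a + (1 - t) * b"
  shows "m powr p \<le> t * \<bar>a\<bar> powr p + (1 - t) * \<bar>b\<bar> powr p"
    and "m powr p = t * \<bar>a\<bar> powr p + (1 - t) * \<bar>b\<bar> powr p \<Longrightarrow> a = m"
proof -
  define c where "c = p * m powr (p - 1)"
  have c: "0 \<le> c" using p by (simp add: c_def)
  have x: "m powr p + c * (x - m) \<le> \<bar>x\<bar> powr p" for x
  proof -
    have "c * (x - m) \<le> c * (\<bar>x\<bar> - m)"
      using c by (intro mult_left_mono) auto
    then show ?thesis
      using powr_tangent_le(1)[OF p abs_ge_zero m(1), of x] by (simp add: c_def)
  qed
  have lin: "t * (m powr p + c * (a - m)) + (1 - t) * (m powr p + c * (b - m)) = m powr p"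
  proof -
    have "t * (a - m) + (1 - t) * (b - m) = 0"
      using m(2) by (simp add: algebra_simps)
    moreover have "t * (m powr p + c * (a - m)) + (1 - t) * (m powr p + c * (b - m))
        = m powr p + c * (t * (a - m) + (1 - t) * (b - m))"
      by (simp add: algebra_simps)
    ultimately show ?thesis by simp
  qed
  have le: "t * (m powr p + c * (a - m)) \<le> t * \<bar>a\<bar> powr p"
    "(1 - t) * (m powr p + c * (b - m)) \<le> (1 - t) * \<bar>b\<bar> powr p"
    using x t by auto
  show "m powr p \<le> t * \<bar>a\<bar> powr p + (1 - t) * \<bar>b\<bar> powr p"
    using lin le by linarith
  assume "m powr p = t * \<bar>a\<bar> powr p + (1 - t) * \<bar>b\<bar> powr p"
  then have "t * (m powr p + c * (a - m)) = t * \<bar>a\<bar> powr p"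
    "(1 - t) * (m powr p + c * (b - m)) = (1 - t) * \<bar>b\<bar> powr p"
    using lin le by linarith+
  then have eq: "m powr p + c * (a - m) = \<bar>a\<bar> powr p" "m powr p + c * (b - m) = \<bar>b\<bar> powr p"
    using t by auto
  have "\<bar>x\<bar> = m" if "m powr p + c * (x - m) = \<bar>x\<bar> powr p" for x
  proof (rule ccontr)
    assume "\<bar>x\<bar> \<noteq> m"
    then have "m powr p + c * (\<bar>x\<bar> - m) < \<bar>x\<bar> powr p"
      using powr_tangent_le(2)[OF p abs_ge_zero m(1), of x] by (simp add: c_def)
    moreover have "c * (x - m) \<le> c * (\<bar>x\<bar> - m)"
      using c by (intro mult_left_mono) auto
    ultimately show False using that by linarith
  qed
  then have ab: "\<bar>a\<bar> = m" "\<bar>b\<bar> = m" using eq by auto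
  \<comment> \<open>This excludes \<open>a = -m\<close> with \<open>m > 0\<close>: both terms are at
    most their counterparts with \<open>m\<close>, and their sums agree.\<close>
  have "t * a \<le> t * m" "(1 - t) * b \<le> (1 - t) * m"
    using ab t by (auto intro!: mult_left_mono)
  moreover have "t * m + (1 - t) * m = m" by (simp add: algebra_simps)
  ultimately have "t * a = t * m" using m(2) by linarith
  then show "a = m" using t by simp
qed

lemma schatten_power_strictly_convex:
  fixes A B :: "real^'n^'m"
  assumes p: "1 < p" and t: "0 < t" "t < 1" and "A \<noteq> B"
  shows "schatten_power p (t *\<^sub>R A + (1 - t) *\<^sub>R B) < t * schatten_power p A + (1 - t) * schatten_power p B"
proof (rule ccontr)
  define M where "M = t *\<^sub>R A + (1 - t) *\<^sub>R B"
  assume "\<not> ?thesis"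
  then have ge: "t * schatten_power p A + (1 - t) * schatten_power p B \<le> schatten_power p M"
    by (simp add: M_def)
  obtain W where W: "singular_basis M W" by (rule singular_basis_exists)
  obtain V where V: "singular_basis A V" by (rule singular_basis_exists)
  obtain V' where V': "singular_basis B V'" by (rule singular_basis_exists)
  note fin = singular_basisD(1)[OF W]
  define u where "u w = sgn (M *v w)" for w
  define a b m where "a w = u w \<bullet> (A *v w)" and "b w = u w \<bullet> (B *v w)" and "m w = norm (M *v w)" for w
  have u: "pairwise (\<lambda>w w'. orthogonal (u w) (u w')) W" "\<And>w. w \<in> W \<Longrightarrow> norm (u w) \<le> 1"
    using singular_basis_sgn[OF W] unfolding u_def by auto
  have um: "M *v w = m w *\<^sub>R u w" for w
    by (cases "M *v w = 0") (simp_all add: m_def u_def sgn_div_norm)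
  have m: "m w = t * a w + (1 - t) * b w" for w
  proof -
    have "m w = u w \<bullet> (M *v w)"
      by (cases "M *v w = 0")
        (simp_all add: m_def u_def sgn_div_norm power2_norm_eq_inner[symmetric] power2_eq_square)
    then show ?thesis
      by (simp add: M_def a_def b_def matrix_vector_mult_add_rdistrib inner_add_right
          scaleR_matrix_vector_assoc[symmetric])
  qed
  have le: "m w powr p \<le> t * \<bar>a w\<bar> powr p + (1 - t) * \<bar>b w\<bar> powr p" for w
    using powr_convex_combination(1)[OF p t _ m] by (simp add: m_def)
  have Ale: "(\<Sum>w\<in>W. \<bar>a w\<bar> powr p) \<le> schatten_power p A"
    unfolding a_def by (intro schatten_power_pinching(1)[OF p V] singular_basisD[OF W] u)
  have Ble: "(\<Sum>w\<in>W. \<bar>b w\<bar> powr p) \<le> schatten_power p B"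
    unfolding b_def by (intro schatten_power_pinching(1)[OF p V'] singular_basisD[OF W] u)
  have "schatten_power p M = (\<Sum>w\<in>W. m w powr p)"
    unfolding schatten_power_eq[OF W] m_def ..
  moreover have "(\<Sum>w\<in>W. t * \<bar>a w\<bar> powr p + (1 - t) * \<bar>b w\<bar> powr p)
      = t * (\<Sum>w\<in>W. \<bar>a w\<bar> powr p) + (1 - t) * (\<Sum>w\<in>W. \<bar>b w\<bar> powr p)"
    by (simp add: sum.distrib sum_distrib_left)
  moreover have "(\<Sum>w\<in>W. m w powr p) \<le> (\<Sum>w\<in>W. t * \<bar>a w\<bar> powr p + (1 - t) * \<bar>b w\<bar> powr p)"
    by (intro sum_mono le)
  moreover have "t * (\<Sum>w\<in>W. \<bar>a w\<bar> powr p) \<le> t * schatten_power p A"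
    "(1 - t) * (\<Sum>w\<in>W. \<bar>b w\<bar> powr p) \<le> (1 - t) * schatten_power p B"
    using Ale Ble t by auto
  \<comment> \<open>The negated claim closes the chain of estimates, so the pinching bound for
    \<open>A\<close> and the summed scalar convexity bound are both equalities.\<close>
  ultimately have eqs: "t * (\<Sum>w\<in>W. \<bar>a w\<bar> powr p) = t * schatten_power p A"
    "(\<Sum>w\<in>W. m w powr p) = (\<Sum>w\<in>W. t * \<bar>a w\<bar> powr p + (1 - t) * \<bar>b w\<bar> powr p)"
    using ge by linarith+
  have "(\<Sum>w\<in>W. (t * \<bar>a w\<bar> powr p + (1 - t) * \<bar>b w\<bar> powr p) - m w powr p) = 0"
    using eqs(2) by (simp add: sum_subtractf)
  then have "\<forall>w\<in>W. (t * \<bar>a w\<bar> powr p + (1 - t) * \<bar>b w\<bar> powr p) - m w powr p = 0"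
    using fin le by (subst (asm) sum_nonneg_eq_0_iff) auto
  then have am: "a w = m w" if "w \<in> W" for w
    using powr_convex_combination(2)[OF p t _ m] that by (simp add: m_def)
  have "(\<Sum>v\<in>V. (norm (A *v v))\<^sup>2) \<le> (\<Sum>w\<in>W. (a w)\<^sup>2)"
    unfolding a_def
  proof (intro schatten_power_pinching(2)[OF p V] singular_basisD[OF W] u)
    show "(\<Sum>w\<in>W. \<bar>u w \<bullet> (A *v w)\<bar> powr p) = schatten_power p A"
      using eqs(1) t by (simp add: a_def)
  qed
  then have AA: "A \<bullet> A \<le> (\<Sum>w\<in>W. (m w)\<^sup>2)"
    using inner_matrix_eq_sum[OF V, of A A] am by (simp add: power2_norm_eq_inner)
  have AM: "A \<bullet> M = (\<Sum>w\<in>W. (m w)\<^sup>2)"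
    unfolding inner_matrix_eq_sum[OF W]
    by (intro sum.cong) (auto simp: um inner_commute power2_eq_square am[symmetric] a_def)
  have MM: "M \<bullet> M = (\<Sum>w\<in>W. (m w)\<^sup>2)"
    unfolding inner_matrix_eq_sum[OF W] by (simp add: m_def power2_norm_eq_inner)
  \<comment> \<open>Equality in pinching gives \<open>A \<bullet> A \<le> M \<bullet> M\<close>,
    while \<open>A \<bullet> M = M \<bullet> M\<close>.\<close>
  have "(A - M) \<bullet> (A - M) \<le> 0"
    using AA AM MM by (simp add: inner_diff inner_commute)
  then have "A = M"
    by (metis inner_eq_zero_iff inner_ge_zero order_antisym right_minus_eq)
  then have "(1 - t) *\<^sub>R (A - B) = 0"
    unfolding M_def by (simp add: algebra_simps)
  then show False
    using t \<open>A \<noteq> B\<close> by simp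
qed

section \<open>From the power to the norm: strict convexity and continuity\<close>

lemma schatten_power_nonneg: "0 \<le> schatten_power p A"
  unfolding schatten_power_def by (intro sum_nonneg) auto

lemma schatten_norm_nonneg: "0 \<le> p \<Longrightarrow> 0 \<le> schatten_norm (ennreal p) A"
  by (simp add: schatten_norm_ennreal)

lemma schatten_power_eq_norm_powr:
  assumes "0 < p"
  shows "schatten_power p A = schatten_norm (ennreal p) A powr p"
  using assms schatten_power_nonneg[of p A] by (simp add: schatten_norm_ennreal powr_powr)

lemma schatten_norm_less:
  assumes "0 < p" "0 \<le> r" "schatten_power p A < r powr p"
  shows "schatten_norm (ennreal p) A < r"
proof -
  have "schatten_power p A powr (1 / p) < (r powr p) powr (1 / p)"
    using assms schatten_power_nonneg by (intro powr_less_mono2) auto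
  then show ?thesis
    using assms by (simp add: schatten_norm_ennreal powr_powr)
qed

lemma strictly_convex_schatten_norm:
  assumes p: "1 < p"
  shows "strictly_convex_norm (schatten_norm (ennreal p) :: real^'n^'m \<Rightarrow> real)"
  unfolding strictly_convex_norm_def
proof (intro allI impI, elim conjE)
  fix A B :: "real^'n^'m" and t :: real
  assume *: "schatten_norm (ennreal p) A = 1" "schatten_norm (ennreal p) B = 1" "A \<noteq> B" "0 < t" "t < 1"
  then show "schatten_norm (ennreal p) (t *\<^sub>R A + (1 - t) *\<^sub>R B) < 1"
    using p schatten_power_strictly_convex[OF p, of t A B]
    by (intro schatten_norm_less) (auto simp: schatten_power_eq_norm_powr)
qed

text \<open>A real-valued convex function on a finite-dimensional space is continuous; this applies
  to the \<open>p\<close>-th power, and the root preserves continuity.\<close>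

lemma continuous_on_schatten_norm:
  assumes p: "1 < p"
  shows "continuous_on UNIV (schatten_norm (ennreal p) :: real^'n^'m \<Rightarrow> real)"
proof -
  have "convex_on UNIV (schatten_power p :: real^'n^'m \<Rightarrow> real)"
  proof (rule convex_onI)
    fix t :: real and A B :: "real^'n^'m"
    assume "0 < t" "t < 1"
    then show "schatten_power p ((1 - t) *\<^sub>R A + t *\<^sub>R B) \<le> (1 - t) * schatten_power p A + t * schatten_power p B"
      using schatten_power_strictly_convex[OF p, of "1 - t" A B]
      by (cases "A = B") (auto simp: algebra_simps)
  qed simp
  then have "continuous_on UNIV (schatten_power p :: real^'n^'m \<Rightarrow> real)"
    by (intro convex_on_continuous) auto
  then have "continuous_on UNIV (\<lambda>A :: real^'n^'m. schatten_power p A powr (1 / p))"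
    using p schatten_power_nonneg by (intro continuous_on_powr') (auto intro!: continuous_intros)
  moreover have "schatten_norm (ennreal p) = (\<lambda>A :: real^'n^'m. schatten_power p A powr (1 / p))"
    using p by (simp add: fun_eq_iff schatten_norm_ennreal)
  ultimately show ?thesis by simp
qed

subsection \<open>The duality map\<close>

lemma Holder_inequality_sum:
  fixes f g :: "'i \<Rightarrow> real"
  assumes "finite I" and pq: "1 < p" "1 < q" "1 / p + 1 / q = 1"
    and f: "\<And>i. i \<in> I \<Longrightarrow> 0 \<le> f i" and g: "\<And>i. i \<in> I \<Longrightarrow> 0 \<le> g i"
  shows "(\<Sum>i\<in>I. f i * g i) \<le> (\<Sum>i\<in>I. f i powr p) powr (1 / p) * (\<Sum>i\<in>I. g i powr q) powr (1 / q)"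
proof -
  define X Y where "X = (\<Sum>i\<in>I. f i powr p)" and "Y = (\<Sum>i\<in>I. g i powr q)"
  have "0 \<le> X" "0 \<le> Y" unfolding X_def Y_def by (auto intro!: sum_nonneg)
  show ?thesis
  proof (cases "X = 0 \<or> Y = 0")
    case True
    then have "f i * g i = 0" if "i \<in> I" for i
      using that \<open>finite I\<close> by (auto simp: X_def Y_def sum_nonneg_eq_0_iff)
    then have "(\<Sum>i\<in>I. f i * g i) = 0"
      by (intro sum.neutral) blast
    then show ?thesis by simp
  next
    case False
    then have pos: "0 < X" "0 < Y" using \<open>0 \<le> X\<close> \<open>0 \<le> Y\<close> by auto
    define x y where "x = X powr (1 / p)" and "y = Y powr (1 / q)"
    have xy: "0 < x" "0 < y" "x powr p = X" "y powr q = Y"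
      using pos pq by (auto simp: x_def y_def powr_powr)
    have "(\<Sum>i\<in>I. (f i / x) * (g i / y)) \<le> (\<Sum>i\<in>I. (f i / x) powr p / p + (g i / y) powr q / q)"
      using xy f g pq by (intro sum_mono Youngs_inequality) auto
    also have "\<dots> = (\<Sum>i\<in>I. f i powr p / (X * p) + g i powr q / (Y * q))"
      using xy f g by (intro sum.cong) (auto simp: powr_divide)
    also have "\<dots> = X / (X * p) + Y / (Y * q)"
      by (simp add: X_def Y_def sum.distrib sum_divide_distrib)
    also have "\<dots> = 1"
      using pos pq by simp
    finally have "(\<Sum>i\<in>I. f i * g i) / (x * y) \<le> 1"
      by (simp add: sum_divide_distrib)
    then show ?thesis
      using xy by (simp add: X_def[symmetric] Y_def[symmetric] x_def y_def divide_le_eq)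
  qed
qed

text \<open>In the singular basis of \<open>A\<close>, the scalar Hoelder inequality separates the
  singular values of \<open>A\<close> from the diagonal coefficients of \<open>B\<close>. Pinching
  bounds the latter by the singular values of \<open>B\<close>.\<close>

lemma schatten_Holder_inequality:
  fixes A B :: "real^'n^'m"
  assumes pq: "1 < p" "1 < q" "1 / p + 1 / q = 1"
  shows "A \<bullet> B \<le> schatten_norm (ennreal p) A * schatten_norm (ennreal q) B"
proof -
  obtain V where V: "singular_basis A V" by (rule singular_basis_exists)
  obtain W where W: "singular_basis B W" by (rule singular_basis_exists)
  have "x \<bullet> y = norm x * (sgn x \<bullet> y)" for x y :: "real^'m"
    by (cases "x = 0") (simp_all add: sgn_div_norm)
  then have "A \<bullet> B = (\<Sum>v\<in>V. norm (A *v v) * (sgn (A *v v) \<bullet> (B *v v)))"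
    unfolding inner_matrix_eq_sum[OF V] by metis
  also have "\<dots> \<le> (\<Sum>v\<in>V. norm (A *v v) * \<bar>sgn (A *v v) \<bullet> (B *v v)\<bar>)"
    by (intro sum_mono mult_left_mono) auto
  also have "\<dots> \<le> (\<Sum>v\<in>V. norm (A *v v) powr p) powr (1 / p) * (\<Sum>v\<in>V. \<bar>sgn (A *v v) \<bullet> (B *v v)\<bar> powr q) powr (1 / q)"
    using pq singular_basisD(1)[OF V] by (intro Holder_inequality_sum) auto
  also have "\<dots> \<le> schatten_power p A powr (1 / p) * schatten_power q B powr (1 / q)"
    unfolding schatten_power_eq[OF V]
  proof (intro mult_left_mono powr_mono2)
    show "(\<Sum>v\<in>V. \<bar>sgn (A *v v) \<bullet> (B *v v)\<bar> powr q) \<le> schatten_power q B"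
      by (intro schatten_power_pinching(1)[OF \<open>1 < q\<close> W] singular_basisD[OF V] singular_basis_sgn[OF V])
  qed (use pq in \<open>auto intro!: sum_nonneg\<close>)
  finally show ?thesis
    using pq by (simp add: schatten_norm_ennreal)
qed

text \<open>Linear extension from the basis prescribes new singular values while keeping the
  singular directions of \<open>A\<close>, which yields the dual elements below.\<close>

lemma singular_basis_rescale:
  fixes A :: "real^'n^'m"
  assumes V: "singular_basis A V"
  obtains B where "singular_basis B V" "\<And>v. v \<in> V \<Longrightarrow> B *v v = c v *\<^sub>R (A *v v)"
proof -
  obtain g where g: "linear g" "\<And>v. v \<in> V \<Longrightarrow> g v = c v *\<^sub>R (A *v v)"
    using linear_independent_extend[OF singular_basisD(6)[OF V], of "\<lambda>v. c v *\<^sub>R (A *v v)"] by blast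
  have eq: "matrix g *v v = c v *\<^sub>R (A *v v)" if "v \<in> V" for v
    using fun_cong[OF matrix_vector_mul(2)[OF g(1)], of v] g(2)[OF that] by (rule trans)
  have "singular_basis (matrix g) V"
    using V by (simp add: singular_basis_def pairwise_def eq orthogonal_def)
  then show ?thesis using eq by (rule that)
qed

lemma schatten_norm_zero: "0 < p \<Longrightarrow> schatten_norm (ennreal p) (0 :: real^'n^'m) = 0"
proof -
  obtain V where "singular_basis (0 :: real^'n^'m) V" by (rule singular_basis_exists)
  then show "0 < p \<Longrightarrow> schatten_norm (ennreal p) (0 :: real^'n^'m) = 0"
    by (simp add: schatten_norm_ennreal schatten_power_eq)
qed

text \<open>In terms of a singular value decomposition \<open>A = \<Sum> s\<^sub>i u\<^sub>i v\<^sub>i\<^sup>T\<close> with \<open>\<alpha> = \<parallel>A\<parallel>\<^sub>p\<close>, the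
  witness is \<open>B = \<alpha> powr (2 - p) \<Sum> (s\<^sub>i powr (p - 1)) u\<^sub>i v\<^sub>i\<^sup>T\<close>.\<close>

lemma schatten_dual_exists:
  fixes A :: "real^'n^'m"
  assumes pq: "1 < p" "1 < q" "1 / p + 1 / q = 1"
  shows "\<exists>B :: real^'n^'m. A \<bullet> B = (schatten_norm (ennreal p) A)\<^sup>2
           \<and> schatten_norm (ennreal q) B = schatten_norm (ennreal p) A"
proof -
  define \<alpha> where "\<alpha> = schatten_norm (ennreal p) A"
  show ?thesis
  proof (cases "\<alpha> = 0")
    case True
    then show ?thesis
      using pq by (intro exI[of _ 0]) (auto simp: \<alpha>_def schatten_norm_zero)
  next
    case False
    then have \<alpha>: "0 < \<alpha>"
      using schatten_norm_nonneg[of p A] pq by (simp add: \<alpha>_def)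
    obtain V where V: "singular_basis A V" by (rule singular_basis_exists)
    define s where "s v = norm (A *v v)" for v
    have s0: "0 \<le> s v" for v by (simp add: s_def)
    have sum_s: "(\<Sum>v\<in>V. s v powr p) = \<alpha> powr p"
      using pq by (simp add: \<alpha>_def s_def schatten_power_eq[OF V, symmetric] schatten_power_eq_norm_powr)
    \<comment> \<open>For \<open>p < 2\<close> the exponent \<open>p - 2\<close> is negative; at
      \<open>s v = 0\<close> both sides are \<open>0\<close> by the convention for
      \<open>0 powr\<close>.\<close>
    have powr_2: "s v powr (p - 2) * s v = s v powr (p - 1)" for v
      using s0[of v] by (cases "s v = 0") (simp_all add: powr_mult_base mult.commute[of _ "s v"])
    have powr_1: "s v powr (p - 1) * s v = s v powr p" for v
      using s0[of v] by (cases "s v = 0") (simp_all add: powr_mult_base mult.commute[of _ "s v"])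
    obtain B :: "real^'n^'m" where B: "singular_basis B V"
      and Bv: "\<And>v. v \<in> V \<Longrightarrow> B *v v = (\<alpha> powr (2 - p) * s v powr (p - 2)) *\<^sub>R (A *v v)"
      using singular_basis_rescale[OF V, of "\<lambda>v. \<alpha> powr (2 - p) * s v powr (p - 2)"] by blast
    have normB: "norm (B *v v) = \<alpha> powr (2 - p) * s v powr (p - 1)" if "v \<in> V" for v
      using Bv[OF that] powr_2[of v] by (simp add: s_def[symmetric] mult.assoc)
    have "A \<bullet> B = (\<Sum>v\<in>V. \<alpha> powr (2 - p) * s v powr p)"
      unfolding inner_matrix_eq_sum[OF V]
    proof (rule sum.cong[OF refl])
      fix v assume "v \<in> V"
      then have "(A *v v) \<bullet> (B *v v) = \<alpha> powr (2 - p) * (s v powr (p - 2) * s v * s v)"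
        by (simp add: Bv s_def power2_norm_eq_inner[symmetric] power2_eq_square)
      then show "(A *v v) \<bullet> (B *v v) = \<alpha> powr (2 - p) * s v powr p"
        by (simp add: powr_2 powr_1)
    qed
    also have "\<dots> = \<alpha> powr (2 - p) * \<alpha> powr p"
      by (simp add: sum_s sum_distrib_left[symmetric])
    also have "\<dots> = \<alpha>\<^sup>2"
      using \<alpha> by (simp add: powr_add[symmetric])
    finally have AB: "A \<bullet> B = \<alpha>\<^sup>2" .
    \<comment> \<open>Both identities restate \<open>p + q = p * q\<close>; they make the
      \<open>q\<close>-norm of \<open>B\<close> equal to \<open>\<alpha>\<close>.\<close>
    have pq': "(p - 1) * q = p" "(2 - p) * q + p = q"
      using pq by (auto simp: field_simps)
    have "schatten_power q B = (\<Sum>v\<in>V. \<alpha> powr ((2 - p) * q) * s v powr p)"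
      unfolding schatten_power_eq[OF B]
      by (intro sum.cong) (auto simp: normB powr_mult powr_powr pq')
    also have "\<dots> = \<alpha> powr ((2 - p) * q) * \<alpha> powr p"
      by (simp add: sum_s sum_distrib_left[symmetric])
    also have "\<dots> = \<alpha> powr q"
      by (simp add: powr_add[symmetric] pq')
    finally have "schatten_norm (ennreal q) B = \<alpha>"
      using pq \<alpha> by (simp add: schatten_norm_ennreal powr_powr)
    then show ?thesis
      using AB by (auto simp: \<alpha>_def)
  qed
qed

section \<open>Conjugate exponents and single-valuedness\<close>

lemma conjugate_exponent_ennreal:
  assumes pq: "1 < p" "1 < q" "1 / p + 1 / q = 1"
  shows "conjugate_exponent (ennreal p) = ennreal q"
proof -
  have "1 / ennreal x = ennreal (1 / x)" if "1 < x" for x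
    using divide_ennreal[of 1 x] that by simp
  then have "1 / ennreal p + 1 / ennreal q = ennreal (1 / p) + ennreal (1 / q)"
    using pq by simp
  also have "\<dots> = ennreal (1 / p + 1 / q)"
    using pq(1,2) by simp
  also have "\<dots> = 1"
    unfolding pq(3) by simp
  finally have "1 / ennreal p + 1 / ennreal q = 1" .
  moreover have "\<exists>!q. 1 / ennreal p + 1 / q = 1"
    using pq by (intro ex1_conjugate_exponent) simp
  ultimately show ?thesis
    unfolding conjugate_exponent_def by (intro the1_equality)
qed

lemma duality_set_ennreal:
  assumes pq: "1 < p" "1 < q" "1 / p + 1 / q = 1"
  shows "duality_set (ennreal p) A =
    {B. A \<bullet> B = (schatten_norm (ennreal p) A)\<^sup>2
        \<and> schatten_norm (ennreal q) B = schatten_norm (ennreal p) A}"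
  unfolding duality_set_def conjugate_exponent_ennreal[OF pq]
  by (auto simp: trace_transpose_mult power2_eq_square)

text \<open>Uniqueness: the midpoint of two elements would violate Hoelder's inequality, because its
  norm is strictly smaller.\<close>

lemma duality_set_ex1:
  fixes A :: "real^'n^'m"
  assumes pq: "1 < p" "1 < q" "1 / p + 1 / q = 1"
  shows "\<exists>!B. B \<in> duality_set (ennreal p) A"
proof (rule ex_ex1I)
  show "\<exists>B. B \<in> duality_set (ennreal p) A"
    using schatten_dual_exists[OF pq, of A] by (simp add: duality_set_ennreal[OF pq])
  fix B C assume BC: "B \<in> duality_set (ennreal p) A" "C \<in> duality_set (ennreal p) A"
  define \<alpha> where "\<alpha> = schatten_norm (ennreal p) A"
  have AB: "A \<bullet> B = \<alpha>\<^sup>2" "A \<bullet> C = \<alpha>\<^sup>2"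
    and n: "schatten_norm (ennreal q) B = \<alpha>" "schatten_norm (ennreal q) C = \<alpha>"
    using BC by (auto simp: duality_set_ennreal[OF pq] \<alpha>_def)
  have "0 \<le> \<alpha>"
    using pq by (simp add: \<alpha>_def schatten_norm_nonneg)
  show "B = C"
  proof (rule ccontr)
    assume "B \<noteq> C"
    define M where "M = (1/2) *\<^sub>R B + (1 - 1/2) *\<^sub>R C"
    have "schatten_power q M < (1/2) * schatten_power q B + (1 - 1/2) * schatten_power q C"
      unfolding M_def by (rule schatten_power_strictly_convex) (use pq \<open>B \<noteq> C\<close> in auto)
    also have "\<dots> = \<alpha> powr q"
      using pq n by (simp add: schatten_power_eq_norm_powr)
    finally have less: "schatten_power q M < \<alpha> powr q" .
    then have "\<alpha> \<noteq> 0"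
      using schatten_power_nonneg[of q M] by auto
    have "\<alpha>\<^sup>2 = A \<bullet> M"
      by (simp add: M_def inner_add_right AB)
    also have "\<dots> \<le> \<alpha> * schatten_norm (ennreal q) M"
      unfolding \<alpha>_def by (rule schatten_Holder_inequality[OF pq])
    also have "\<dots> < \<alpha> * \<alpha>"
      using less pq \<open>0 \<le> \<alpha>\<close> \<open>\<alpha> \<noteq> 0\<close> by (intro mult_strict_left_mono schatten_norm_less) auto
    finally show False
      by (simp add: power2_eq_square)
  qed
qed

text \<open>Continuity gives closedness. Each singular value is at most the Schatten norm, and the
  squared Frobenius norm is the sum of at most \<open>DIM(real^'n)\<close> squared singular
  values.\<close>

lemma compact_schatten_ball:
  assumes q: "1 < q"
  shows "compact {B :: real^'n^'m. schatten_norm (ennreal q) B \<le> r}"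
proof -
  have "closed {B :: real^'n^'m. schatten_norm (ennreal q) B \<le> r}"
    using continuous_on_schatten_norm[OF q] by (intro closed_Collect_le) auto
  moreover have "bounded {B :: real^'n^'m. schatten_norm (ennreal q) B \<le> r}"
  proof (rule boundedI)
    fix B :: "real^'n^'m" assume "B \<in> {B. schatten_norm (ennreal q) B \<le> r}"
    then have r: "schatten_norm (ennreal q) B \<le> r" by simp
    then have "0 \<le> r"
      using schatten_norm_nonneg[of q B] q by simp
    obtain V where V: "singular_basis B V" by (rule singular_basis_exists)
    have le: "norm (B *v v) \<le> r" if "v \<in> V" for v
    proof -
      have "norm (B *v v) powr q \<le> schatten_power q B"
        unfolding schatten_power_eq[OF V]
        using singular_basisD(1)[OF V] that by (intro member_le_sum) auto
      then have "(norm (B *v v) powr q) powr (1 / q) \<le> schatten_norm (ennreal q) B"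
        using q by (simp add: schatten_norm_ennreal powr_mono2)
      then have "norm (B *v v) \<le> schatten_norm (ennreal q) B"
        using q by (simp add: powr_powr)
      then show ?thesis using r by simp
    qed
    have "(norm B)\<^sup>2 = (\<Sum>v\<in>V. (norm (B *v v))\<^sup>2)"
      using inner_matrix_eq_sum[OF V, of B B] by (simp add: power2_norm_eq_inner)
    also have "\<dots> \<le> real (card V) * r\<^sup>2"
      using le by (intro sum_bounded_above power_mono) auto
    also have "\<dots> \<le> real (DIM(real^'n)) * r\<^sup>2"
      using independent_bound[OF singular_basisD(6)[OF V]] by (intro mult_right_mono) auto
    also have "\<dots> = (sqrt (real (DIM(real^'n))) * r)\<^sup>2"
      by (simp add: power_mult_distrib)
    finally show "norm B \<le> sqrt (real (DIM(real^'n))) * r"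
      by (rule power2_le_imp_le) (use \<open>0 \<le> r\<close> in simp)
  qed
  ultimately show ?thesis
    by (simp add: compact_eq_bounded_closed)
qed

lemma continuous_on_duality_map:
  assumes pq: "1 < p" "1 < q" "1 / p + 1 / q = 1"
  shows "continuous_on UNIV (duality_map (ennreal p) :: real^'n^'m \<Rightarrow> real^'n^'m)"
proof -
  let ?J = "duality_map (ennreal p) :: real^'n^'m \<Rightarrow> real^'n^'m"
  \<comment> \<open>Uniqueness turns the graph of \<open>?J\<close> into the solution set of two
    equations between continuous functions, hence a closed set.\<close>
  have J: "B = ?J A \<longleftrightarrow> A \<bullet> B = (schatten_norm (ennreal p) A)\<^sup>2
      \<and> schatten_norm (ennreal q) B = schatten_norm (ennreal p) A" for A B :: "real^'n^'m"
  proof -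
    have "B = ?J A \<longleftrightarrow> B \<in> duality_set (ennreal p) A"
      unfolding duality_map_def
      using duality_set_ex1[OF pq, of A] by (metis the1_equality theI')
    then show ?thesis by (simp add: duality_set_ennreal[OF pq])
  qed
  have cont: "continuous_on X (\<lambda>x. schatten_norm (ennreal r) (f x :: real^'n^'m))"
    if "1 < r" "continuous_on X f" for r X and f :: "'z::topological_space \<Rightarrow> _"
    using continuous_on_compose2[OF continuous_on_schatten_norm[OF that(1)] that(2)] by simp
  have closed: "closed {(A, B). B = ?J A}"
    unfolding J split_def
    using pq by (intro closed_Collect_conj closed_Collect_eq continuous_intros cont) auto
  have "isCont ?J A" for A
  proof -
    \<comment> \<open>Adding \<open>1\<close> puts \<open>A\<close> inside the open set
      \<open>S\<close>, on which \<open>?J\<close> takes values in the compact set \<open>T\<close>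
      because it preserves norms. A closed graph over \<open>S\<close> then gives
      continuity.\<close>
    define r where "r = schatten_norm (ennreal p) A + 1"
    define S where "S = {A :: real^'n^'m. schatten_norm (ennreal p) A < r}"
    define T where "T = {B :: real^'n^'m. schatten_norm (ennreal q) B \<le> r}"
    have "open S"
      unfolding S_def using pq by (intro open_Collect_less cont) auto
    have "?J \<in> S \<rightarrow> T"
    proof
      fix A :: "real^'n^'m" assume "A \<in> S"
      then show "?J A \<in> T"
        using J[of "?J A" A] by (simp add: S_def T_def)
    qed
    moreover have "(\<lambda>x. (x, ?J x)) ` S = (S \<times> T) \<inter> {(A, B). B = ?J A}"
      using \<open>?J \<in> S \<rightarrow> T\<close> by auto
    ultimately have "continuous_on S ?J"
      using continuous_closed_graph_eq[of T ?J S] compact_schatten_ball[OF pq(2), of r] closed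
      by (simp add: T_def closedin_closed_Int)
    then show ?thesis
      using \<open>open S\<close> by (simp add: continuous_on_eq_continuous_at S_def r_def)
  qed
  then show ?thesis
    by (simp add: continuous_at_imp_continuous_on)
qed

subsection \<open>The exponents \<open>1\<close> and \<open>\<infinity>\<close>\<close>

lemma norm_axis_real: "norm (axis i (a :: real)) = \<bar>a\<bar>"
  by (simp add: norm_eq_sqrt_inner inner_axis_axis)

context
  fixes i1 i2 :: "'m::finite" and j1 j2 :: "'n::finite"
  assumes i: "i1 \<noteq> i2" and j: "j1 \<noteq> j2"
begin

definition two_entries :: "real \<Rightarrow> real \<Rightarrow> real^'n^'m" where
  "two_entries a b = (\<chi> i j. if i = i1 \<and> j = j1 then a else if i = i2 \<and> j = j2 then b else 0)"

lemma two_entries_axis: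
  "two_entries a b *v axis j 1 = (if j = j1 then axis i1 a else if j = j2 then axis i2 b else 0)"
  unfolding matrix_vector_mult_basis
  using i j by (auto simp: two_entries_def column_def vec_eq_iff axis_def)

text \<open>The coordinate vectors work because the two nonzero entries lie in different rows and
  columns: the images are multiples of distinct coordinate vectors or zero.\<close>

lemma singular_basis_two_entries: "singular_basis (two_entries a b) (range (\<lambda>j. axis j 1))"
proof -
  have "range (\<lambda>j::'n. axis j (1::real)) = Basis"
    by (auto simp: Basis_vec_def)
  then have "span (range (\<lambda>j::'n. axis j (1::real))) = UNIV"
    by (simp add: span_Basis)
  then show ?thesis
    using i j
    by (auto simp: singular_basis_def pairwise_def orthogonal_def two_entries_axis inner_axis_axis)
qed

lemma schatten_norm_1_two_entries: "schatten_norm 1 (two_entries a b) = \<bar>a\<bar> + \<bar>b\<bar>"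
proof -
  have inj: "inj (\<lambda>j::'n. axis j (1::real))"
    by (auto simp: inj_def axis_eq_axis)
  have "schatten_norm 1 (two_entries a b) = \<bar>schatten_power 1 (two_entries a b)\<bar>"
    using schatten_norm_ennreal[of 1 "two_entries a b"] schatten_power_nonneg[of 1 "two_entries a b"] by simp
  also have "\<dots> = schatten_power 1 (two_entries a b)"
    using schatten_power_nonneg by (rule abs_of_nonneg)
  also have "\<dots> = (\<Sum>j\<in>UNIV. norm (two_entries a b *v axis j 1))"
    unfolding schatten_power_eq[OF singular_basis_two_entries] by (simp add: sum.reindex[OF inj])
  also have "\<dots> = (\<Sum>j\<in>UNIV. (if j = j1 then \<bar>a\<bar> else 0) + (if j = j2 then \<bar>b\<bar> else 0))"
    using j by (intro sum.cong) (auto simp: two_entries_axis norm_axis_real)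
  also have "\<dots> = \<bar>a\<bar> + \<bar>b\<bar>"
    by (simp add: sum.distrib)
  finally show ?thesis .
qed

text \<open>Putting the dominant entry first avoids a maximum and covers \<open>(1, 1)\<close>,
  \<open>(1, 0)\<close> and their midpoint.\<close>

lemma schatten_norm_infinity_two_entries:
  assumes "\<bar>b\<bar> \<le> \<bar>a\<bar>"
  shows "schatten_norm \<infinity> (two_entries a b) = \<bar>a\<bar>"
  unfolding schatten_norm_infinity[OF singular_basis_two_entries]
proof (rule Max_eqI)
  show "\<bar>a\<bar> \<in> (\<lambda>v. norm (two_entries a b *v v)) ` range (\<lambda>j. axis j 1)"
    by (auto simp: image_iff two_entries_axis norm_axis_real intro!: exI[of _ j1])
qed (use assms in \<open>auto simp: two_entries_axis norm_axis_real\<close>)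

lemma two_entries_convex_combination:
  "t *\<^sub>R two_entries a b + u *\<^sub>R two_entries c d = two_entries (t * a + u * c) (t * b + u * d)"
  by (auto simp: two_entries_def vec_eq_iff)

lemma two_entries_eq_iff: "two_entries a b = two_entries c d \<longleftrightarrow> a = c \<and> b = d"
  using i by (auto simp: two_entries_def vec_eq_iff)

text \<open>The midpoint of \<open>(1, 0)\<close> and \<open>(0, 1)\<close> still has sum norm
  \<open>1\<close>.\<close>

lemma not_strictly_convex_schatten_norm_1:
  "\<not> strictly_convex_norm (schatten_norm 1 :: real^'n^'m \<Rightarrow> real)"
proof
  assume "strictly_convex_norm (schatten_norm 1 :: real^'n^'m \<Rightarrow> real)"
  then have "schatten_norm 1 ((1/2) *\<^sub>R two_entries 1 0 + (1 - 1/2) *\<^sub>R two_entries 0 1) < 1"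
    unfolding strictly_convex_norm_def
    by (elim allE[of _ "two_entries 1 0"] allE[of _ "two_entries 0 1"] impE allE[of _ "1/2"])
      (auto simp: schatten_norm_1_two_entries two_entries_eq_iff)
  then show False
    by (simp only: two_entries_convex_combination schatten_norm_1_two_entries) simp
qed

text \<open>The segment from \<open>(1, 1)\<close> to \<open>(1, 0)\<close> lies in a face of the
  unit ball of the maximum norm.\<close>

lemma not_strictly_convex_schatten_norm_infinity:
  "\<not> strictly_convex_norm (schatten_norm \<infinity> :: real^'n^'m \<Rightarrow> real)"
proof
  assume "strictly_convex_norm (schatten_norm \<infinity> :: real^'n^'m \<Rightarrow> real)"
  then have "schatten_norm \<infinity> ((1/2) *\<^sub>R two_entries 1 1 + (1 - 1/2) *\<^sub>R two_entries 1 0) < 1"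
    unfolding strictly_convex_norm_def
    by (elim allE[of _ "two_entries 1 1"] allE[of _ "two_entries 1 0"] impE allE[of _ "1/2"])
      (auto simp: schatten_norm_infinity_two_entries[simplified] two_entries_eq_iff)
  then show False
    by (simp only: two_entries_convex_combination) (simp add: schatten_norm_infinity_two_entries[simplified])
qed

end

text \<open>With a single row or column there is at most one positive singular value, so every
  Schatten norm is the Euclidean norm and is strictly convex. The failure at \<open>1\<close> and
  \<open>\<infinity>\<close> therefore requires at least two rows and two columns.\<close>

theorem corollary1:
  fixes p :: ennreal
  assumes "1 \<le> p"
  shows
    "(2 \<le> CARD('m::finite) \<and> 2 \<le> CARD('n::finite) \<longrightarrow>
        (strictly_convex_norm (schatten_norm p :: real^'n^'m \<Rightarrow> real) \<longleftrightarrow> 1 < p \<and> p < \<infinity>))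
     \<and> (1 < p \<and> p < \<infinity> \<longrightarrow>
        strictly_convex_norm (schatten_norm p :: real^'n^'m \<Rightarrow> real)
        \<and> continuous_on UNIV (duality_map p :: real^'n^'m \<Rightarrow> real^'n^'m))"
proof -
  have yes: "strictly_convex_norm (schatten_norm p :: real^'n^'m \<Rightarrow> real)
      \<and> continuous_on UNIV (duality_map p :: real^'n^'m \<Rightarrow> real^'n^'m)" if p: "1 < p" "p < \<infinity>"
  proof -
    obtain r where r: "p = ennreal r" "0 \<le> r"
      using p(2) by (cases p) auto
    then have "1 < r"
      using p(1) by simp
    \<comment> \<open>This is the solution of \<open>1 / r + 1 / q = 1\<close>.\<close>
    define q where "q = r / (r - 1)"
    have "1 < q" "1 / r + 1 / q = 1"
      using \<open>1 < r\<close> by (auto simp: q_def field_simps)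
    then show ?thesis
      using r(1) \<open>1 < r\<close> strictly_convex_schatten_norm continuous_on_duality_map by auto
  qed
  have no: "\<not> strictly_convex_norm (schatten_norm p :: real^'n^'m \<Rightarrow> real)"
    if card: "2 \<le> CARD('m)" "2 \<le> CARD('n)" "\<not> (1 < p \<and> p < \<infinity>)"
  proof -
    obtain i1 i2 :: 'm where i: "i1 \<noteq> i2"
      using card(1) by (metis UNIV_I card_le_Suc0_iff_eq finite not_less_eq_eq numeral_2_eq_2)
    obtain j1 j2 :: 'n where j: "j1 \<noteq> j2"
      using card(2) by (metis UNIV_I card_le_Suc0_iff_eq finite not_less_eq_eq numeral_2_eq_2)
    have "p = 1 \<or> p = \<infinity>"
      using card(3) assms by (metis antisym_conv2 infinity_ennreal_def top.not_eq_extremum)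
    then show ?thesis
      using not_strictly_convex_schatten_norm_1[OF i j]
        not_strictly_convex_schatten_norm_infinity[OF i j] by auto
  qed
  show ?thesis
    using yes no by blast
qed

end
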